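(* We have $$\lim_{d\to\infty}\frac{1}{(qx)^d}\Bigl(\tilde{A}_d(q,x)-[d]_{qx}\Bigr)=\sum_{k\ge0}(qx)^k(1+x)(1+2x)\cdots(1+kx),$$ where $\tilde{A}_d(q,x)=\sum_{\alpha\in\tilde{A}_d}q^{\max\alpha}x^{|\alpha|}$ and $[d]_{qx}=1+qx+(qx)^2+\dots+(qx)^{d-1}$.
   Context: All sequences are finite words $\alpha=a_1\ldots a_n$ ($n\ge0$) of positive integers; $|\alpha|=n$, and $\max\epsilon=0$ for the empty word. For an integer $d\ge 0$, an index $i\in[n]$ is a $d$-ascent of $\alpha$ if $i=1$, or $i\ge 2$ and $a_i>a_{i-1}-d$; $\mathrm{asc}_d\alpha$ is the number of $d$-ascents. $\alpha$ is a $d$-ascent sequence if $a_i\le1+\mathrm{asc}_d(a_1\ldots a_{i-1})$ for all $i\in[n]$; $A_d$ is the set of these. For a word $\alpha$ and index $j$, $M(\alpha,j)$ adds $1$ to every $a_i$ with $i<j$ and $a_i\ge a_j$; $M(\alpha,j_1,\dots,j_k)=M(M(\alpha,j_1,\dots,j_{k-1}),j_k)$; $\mathrm{hat}_d(\alpha)=M(\alpha,j_1,\dots,j_k)$ with $j_1<\dots<j_k$ the $d$-ascents of $\alpha$. $\tilde{A}_d=\{\alpha\in A_d:\mathrm{hat}_d(\alpha)=\alpha\}$. The limit of a sequence $G_0,G_1,\dots$ of power series in $x$ (with coefficients polynomials in $q$) is $\sum_n c_nx^n$ if for each $n$ there is $K$ such that the coefficient of $x^n$ in $G_k$ equals $c_n$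 for all $k\ge K$. *)

theory Defs
  imports "HOL-Computational_Algebra.Computational_Algebra"
begin

text \<open>
  A word \<open>a\<^sub>1 \<dots> a\<^sub>n\<close> of positive integers is a list of positive naturals. Indices are shifted by
  one: the letter \<open>a\<^sub>i\<close> is \<open>w ! (i - 1)\<close>, so all positions below range over \<open>{0..<n}\<close>.
\<close>

definition is_word :: "nat list \<Rightarrow> bool" where
  "is_word w \<longleftrightarrow> (\<forall>a\<in>set w. 0 < a)"

definition max_letter :: "nat list \<Rightarrow> nat" where
  "max_letter w = Max (insert 0 (set w))"

text \<open>The comparison takes place in the integers, since \<open>a\<^bsub>i-1\<^esub> - d\<close> may be negative.\<close>

definition d_ascent :: "nat \<Rightarrow> nat list \<Rightarrow> nat \<Rightarrow> bool" where
  "d_ascent d w i \<longleftrightarrow>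
     i < length w \<and> (i = 0 \<or> (1 \<le> i \<and> int (w ! i) > int (w ! (i - 1)) - int d))"

definition asc :: "nat \<Rightarrow> nat list \<Rightarrow> nat" where
  "asc d w = card {i. d_ascent d w i}"

definition ascent_seqs :: "nat \<Rightarrow> nat list set" where
  "ascent_seqs d =
     {w. is_word w \<and> (\<forall>i<length w. w ! i \<le> 1 + asc d (take i w))}"

definition M :: "nat list \<Rightarrow> nat \<Rightarrow> nat list" where
  "M w j = map (\<lambda>i. if i < j \<and> w ! i \<ge> w ! j then w ! i + 1 else w ! i) [0..<length w]"

text \<open>The list of \<open>d\<close>-ascents is that of the original word; it is not recomputed along the fold.\<close>

definition hat :: "nat \<Rightarrow> nat list \<Rightarrow> nat list" where
  "hat d w = foldl M w (filter (d_ascent d w) [0..<length w])"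

definition self_modified :: "nat \<Rightarrow> nat list set" where
  "self_modified d = {w \<in> ascent_seqs d. hat d w = w}"

lemma ascent_seqs_letter_le:
  assumes "w \<in> ascent_seqs d" "i < length w"
  shows "w ! i \<le> i + 1"
proof -
  have "card {j. d_ascent d (take i w) j} \<le> card {..<i}"
    by (rule card_mono) (auto simp: d_ascent_def)
  then have "asc d (take i w) \<le> i"
    by (simp add: asc_def)
  with assms show ?thesis
    unfolding ascent_seqs_def by force
qed

text \<open>The coefficient sums in the generating function below are therefore finite.\<close>

lemma finite_self_modified_length: "finite {w \<in> self_modified d. length w = n}"
proof (rule finite_subset)
  show "{w \<in> self_modified d. length w = n} \<subseteq> {w. set w \<subseteq> {..n} \<and> length w = n}"
  proof (clarsimp simp: self_modified_def)
    fix w a assume "w \<in> ascent_seqs d" "a \<in> set w" "n = length w"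
    then show "a \<le> length w"
      by (metis Suc_eq_plus1 Suc_leI ascent_seqs_letter_le in_set_conv_nth order_trans)
  qed
  show "finite {w. set w \<subseteq> {..n} \<and> length w = n}"
    by (rule finite_lists_length_eq) simp
qed

text \<open>Power series in \<open>x\<close> whose coefficients are polynomials in \<open>q\<close> have type \<open>int poly fps\<close>.\<close>

definition x :: "int poly fps" where
  "x = fps_X"

definition q :: "int poly fps" where
  "q = fps_const (monom 1 1)"

definition self_modified_gf :: "nat \<Rightarrow> int poly fps" where
  "self_modified_gf d =
     Abs_fps (\<lambda>n. \<Sum>w\<in>{w \<in> self_modified d. length w = n}. monom 1 (max_letter w))"

definition bracket :: "nat \<Rightarrow> int poly fps \<Rightarrow> int poly fps" where
  "bracket d t = (\<Sum>i<d. t ^ i)"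

definition rhs_term :: "nat \<Rightarrow> int poly fps" where
  "rhs_term k = (q * x) ^ k * (\<Prod>i=1..k. 1 + of_nat i * x)"

text \<open>
  Convergence in the topology of formal power series is eventual constancy of each coefficient,
  and in this topology the series of the \<open>rhs_term\<close>s converges, so that \<open>suminf\<close> yields its sum.
\<close>

lemma LIMSEQ_fps_iff:
  "(G \<longlonglongrightarrow> (L :: int poly fps)) \<longleftrightarrow>
     (\<forall>n. \<exists>K. \<forall>k\<ge>K. fps_nth (G k) n = fps_nth L n)"
  by (simp add: tendsto_fps_iff eventually_sequentially)

lemma rhs_term_nth_eq_0:
  assumes "n < k"
  shows "fps_nth (rhs_term k) n = 0"
proof -
  have "rhs_term k = fps_X ^ k * (q ^ k * (\<Prod>i=1..k. 1 + of_nat i * x))"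
    by (simp add: rhs_term_def x_def power_mult_distrib mult_ac)
  then show ?thesis
    using assms by (simp only: fps_X_power_mult_nth if_True)
qed

lemma rhs_term_sums:
  "rhs_term sums Abs_fps (\<lambda>n. \<Sum>k\<le>n. fps_nth (rhs_term k) n)"
  unfolding sums_def LIMSEQ_fps_iff
proof
  fix n
  have "fps_nth (\<Sum>i<m. rhs_term i) n = (\<Sum>k\<le>n. fps_nth (rhs_term k) n)" if "m \<ge> Suc n" for m
    unfolding fps_sum_nth
    by (rule sum.mono_neutral_right) (use that rhs_term_nth_eq_0 in auto)
  then show "\<exists>K. \<forall>k\<ge>K. fps_nth (sum rhs_term {..<k}) n =
      fps_nth (Abs_fps (\<lambda>n. \<Sum>k\<le>n. fps_nth (rhs_term k) n)) n"
    by auto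
qed

end

theory Submission
  imports Defs
begin

text \<open>
  A word is fixed by \<open>hat d\<close> iff each of its \<open>d\<close>-ascents is a strict left-to-right maximum. Hence a
  self-modified word is built by successively appending either the current maximum plus one, or a
  letter \<open>a > 0\<close> with \<open>a + d \<le> b\<close>, where \<open>b\<close> is the last letter. If the maximum is at most \<open>2 * d\<close>,
  then a letter of the second kind is at most \<open>d\<close>, so it is followed by a new maximum.
  Thus the value \<open>m\<close> is introduced in one step, optionally followed by one of \<open>m - d\<close> small letters,
  and contributes the factor \<open>x * (1 + (m - d) * x)\<close>, with truncated subtraction. The first \<open>d\<close> of these factors are
  \<open>x\<close>, which accounts for the bracket and for the division by \<open>(q * x) ^ d\<close>.
\<close>

section \<open>Words fixed by \<open>hat d\<close>\<close>

lemma length_M [simp]: "length (M w j) = length w"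
  by (simp add: M_def)

lemma nth_le_nth_M: "i < length w \<Longrightarrow> w ! i \<le> M w j ! i"
  by (simp add: M_def)

lemma length_foldl_M [simp]: "length (foldl M w js) = length w"
  by (induction js arbitrary: w) simp_all

lemma nth_le_nth_foldl_M: "i < length w \<Longrightarrow> w ! i \<le> foldl M w js ! i"
proof (induction js arbitrary: w)
  case (Cons j js)
  then show ?case
    using order_trans[OF nth_le_nth_M[of i w j] Cons.IH[of "M w j"]] by simp
qed simp

lemma M_eq_iff: "M w j = w \<longleftrightarrow> (\<forall>i<length w. i < j \<longrightarrow> w ! i < w ! j)"
proof -
  have "M w j ! i = w ! i \<longleftrightarrow> (i < j \<longrightarrow> w ! i < w ! j)" if "i < length w" for i
    using that by (simp add: M_def not_le)
  then show ?thesis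
    by (simp add: list_eq_iff_nth_eq)
qed

text \<open>\<open>M\<close> never decreases a letter, so a change made by one step cannot be undone
  by the later ones.\<close>

lemma foldl_M_eq_iff: "foldl M w js = w \<longleftrightarrow> (\<forall>j\<in>set js. M w j = w)"
proof (induction js arbitrary: w)
  case (Cons j js)
  show ?case
  proof (cases "M w j = w")
    case True
    then show ?thesis using Cons.IH by simp
  next
    case False
    have "M w j = w" if fixed: "foldl M (M w j) js = w"
    proof (rule nth_equalityI)
      fix i assume "i < length (M w j)"
      then show "M w j ! i = w ! i"
        using nth_le_nth_M[of i w j] nth_le_nth_foldl_M[of i "M w j" js] fixed by simp
    qed simp
    then show ?thesis using False by auto
  qed
qed simp

lemma hat_eq_iff: "hat d w = w \<longleftrightarrow> (\<forall>j. d_ascent d w j \<longrightarrow> (\<forall>i<j. w ! i < w ! j))"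
proof -
  have "set (filter (d_ascent d w) [0..<length w]) = {j. d_ascent d w j}"
    by (auto simp: d_ascent_def)
  moreover have "i < length w" if "d_ascent d w j" "i < j" for i j
    using that by (simp add: d_ascent_def)
  ultimately show ?thesis
    unfolding hat_def foldl_M_eq_iff M_eq_iff by blast
qed

section \<open>Appending a letter\<close>

lemma d_ascent_snoc:
  "d_ascent d (u @ [a]) j \<longleftrightarrow>
     d_ascent d u j \<or> j = length u \<and> (u = [] \<or> last u < a + d)"
  by (cases "u = []")
    (auto simp: d_ascent_def nth_append last_conv_nth less_Suc_eq)

lemma finite_d_ascents: "finite {j. d_ascent d w j}"
  by (rule finite_subset[of _ "{..<length w}"]) (auto simp: d_ascent_def)

lemma asc_snoc:
  "asc d (u @ [a]) = asc d u + (if u = [] \<or> last u < a + d then 1 else 0)"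
proof -
  have "length u \<notin> {j. d_ascent d u j}"
    by (simp add: d_ascent_def)
  moreover have "{j. d_ascent d (u @ [a]) j} =
      (if u = [] \<or> last u < a + d then insert (length u) {j. d_ascent d u j}
       else {j. d_ascent d u j})"
    by (auto simp: d_ascent_snoc)
  ultimately show ?thesis
    by (simp add: asc_def finite_d_ascents)
qed

lemma ascent_seqs_snoc:
  "u @ [a] \<in> ascent_seqs d \<longleftrightarrow> u \<in> ascent_seqs d \<and> 0 < a \<and> a \<le> 1 + asc d u"
proof -
  have "(u @ [a]) ! i \<le> 1 + asc d (take i (u @ [a])) \<longleftrightarrow> u ! i \<le> 1 + asc d (take i u)"
    if "i < length u" for i
    using that by (simp add: nth_append)
  then have "(\<forall>i<length (u @ [a]). (u @ [a]) ! i \<le> 1 + asc d (take i (u @ [a]))) \<longleftrightarrow>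
      (\<forall>i<length u. u ! i \<le> 1 + asc d (take i u)) \<and> a \<le> 1 + asc d u"
    by (simp add: All_less_Suc conj_commute)
  then show ?thesis
    unfolding ascent_seqs_def is_word_def by auto
qed

lemma hat_snoc_eq_iff:
  "hat d (u @ [a]) = u @ [a] \<longleftrightarrow>
     hat d u = u \<and> (u = [] \<or> last u < a + d \<longrightarrow> (\<forall>b\<in>set u. b < a))"
proof -
  let ?max = "\<lambda>w j. \<forall>i<j. w ! i < w ! j"
  have "hat d (u @ [a]) = u @ [a] \<longleftrightarrow>
      (\<forall>j. d_ascent d u j \<longrightarrow> ?max (u @ [a]) j) \<and>
      (u = [] \<or> last u < a + d \<longrightarrow> ?max (u @ [a]) (length u))"
    unfolding hat_eq_iff d_ascent_snoc by blast
  moreover have "?max (u @ [a]) j \<longleftrightarrow> ?max u j" if "d_ascent d u j" for j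
    using that by (simp add: d_ascent_def nth_append)
  moreover have "?max (u @ [a]) (length u) \<longleftrightarrow> (\<forall>b\<in>set u. b < a)"
    by (simp add: nth_append all_set_conv_all_nth)
  ultimately show ?thesis
    by (simp add: hat_eq_iff)
qed

lemma max_letter_Nil [simp]: "max_letter [] = 0"
  by (simp add: max_letter_def)

lemma max_letter_snoc [simp]: "max_letter (u @ [a]) = max (max_letter u) a"
  by (simp add: max_letter_def insert_commute[of 0 a] max.commute)

lemma last_le_max_letter: "u \<noteq> [] \<Longrightarrow> last u \<le> max_letter u"
  by (simp add: max_letter_def)

lemma max_letter_less_iff: "max_letter u < a \<longleftrightarrow> 0 < a \<and> (\<forall>b\<in>set u. b < a)"
  by (auto simp: max_letter_def)

lemma Nil_in_self_modified [simp]: "[] \<in> self_modified d"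
  by (simp add: self_modified_def ascent_seqs_def is_word_def hat_def)

lemma self_modified_snoc_asc:
  "u @ [a] \<in> self_modified d \<longleftrightarrow>
     u \<in> self_modified d \<and> 0 < a \<and> a \<le> 1 + asc d u \<and>
     (u = [] \<or> last u < a + d \<longrightarrow> max_letter u < a)"
  by (auto simp: self_modified_def ascent_seqs_snoc hat_snoc_eq_iff max_letter_less_iff)

text \<open>An appended letter that is a \<open>d\<close>-ascent must exceed the maximum, yet be at
  most \<open>1 + asc d u\<close>, which by induction is the maximum plus one; so both quantities
  grow by one. A letter that is not a \<open>d\<close>-ascent is at most \<open>last u\<close> and
  changes neither.\<close>

lemma asc_self_modified: "w \<in> self_modified d \<Longrightarrow> asc d w = max_letter w"
proof (induction w rule: rev_induct)
  case Nil
  show ?case by (simp add: asc_def d_ascent_def)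
next
  case (snoc a u)
  then show ?case
    using last_le_max_letter[of u] by (auto simp: self_modified_snoc_asc asc_snoc)
qed

lemma self_modified_snoc:
  "u @ [a] \<in> self_modified d \<longleftrightarrow>
     u \<in> self_modified d \<and>
     (a = Suc (max_letter u) \<or> u \<noteq> [] \<and> 0 < a \<and> a + d \<le> last u)"
  using last_le_max_letter[of u]
  by (auto simp: self_modified_snoc_asc asc_self_modified)

lemma max_letter_le_length: "w \<in> self_modified d \<Longrightarrow> max_letter w \<le> length w"
proof (induction w rule: rev_induct)
  case (snoc a u)
  then show ?case
    using last_le_max_letter[of u] by (auto simp: self_modified_snoc)
qed simp

lemma self_modified_max_letter_0_iff:
  "w \<in> self_modified d \<and> max_letter w = 0 \<longleftrightarrow> w = []"
  by (cases w rule: rev_cases) (auto simp: self_modified_snoc)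

section \<open>Counting words by length and maximum\<close>

definition level_words :: "nat \<Rightarrow> nat \<Rightarrow> nat \<Rightarrow> nat list set" where
  "level_words d m n = {w \<in> self_modified d. length w = n \<and> max_letter w = m}"

lemma finite_level_words [simp]: "finite (level_words d m n)"
  by (rule finite_subset[OF _ finite_self_modified_length[of d n]]) (auto simp: level_words_def)

lemma level_words_Suc_0: "level_words d (Suc m) 0 = {}"
  by (auto simp: level_words_def)

text \<open>The bound \<open>2 * d\<close> rules out two small letters in a row, so at most one
  letter follows the first occurrence of the maximum.\<close>

lemma self_modified_max_letter_Suc:
  assumes "Suc m \<le> 2 * d"
  shows "w \<in> self_modified d \<and> max_letter w = Suc m \<longleftrightarrow>
    (\<exists>u\<in>self_modified d. max_letter u = m \<and>
       (w = u @ [Suc m] \<or> (\<exists>a\<in>{1..Suc m - d}. w = u @ [Suc m, a])))"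
    (is "?L \<longleftrightarrow> ?R")
proof
  assume L: ?L
  then obtain v a where w: "w = v @ [a]"
    by (cases w rule: rev_cases) auto
  show ?R
  proof (cases "a = Suc (max_letter v)")
    case True
    with L w show ?thesis by (auto simp: self_modified_snoc)
  next
    case False
    with L w have v: "v \<in> self_modified d" "v \<noteq> []" "0 < a" "a + d \<le> last v"
      by (auto simp: self_modified_snoc)
    with L w last_le_max_letter[of v] have maxv: "max_letter v = Suc m"
      by auto
    from v(2) obtain u b where u: "v = u @ [b]"
      by (cases v rule: rev_cases) auto
    \<comment> \<open>Were \<open>b\<close> small too, then
      \<open>a + 2 * d \<le> b + d \<le> Suc m \<le> 2 * d\<close>, contradicting
      \<open>0 < a\<close>.\<close>
    have "b = Suc (max_letter u)"
    proof (rule ccontr)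
      assume "b \<noteq> Suc (max_letter u)"
      with v(1) u have "u \<noteq> []" "b + d \<le> last u"
        by (auto simp: self_modified_snoc)
      with last_le_max_letter[of u] maxv u have "b + d \<le> Suc m"
        by auto
      with assms v u show False by simp
    qed
    with v u maxv have "u \<in> self_modified d" "max_letter u = m" "b = Suc m" "a \<in> {1..Suc m - d}"
      by (auto simp: self_modified_snoc)
    with w u show ?thesis by auto
  qed
next
  have "u @ [Suc m, a] \<in> self_modified d \<and> max_letter (u @ [Suc m, a]) = Suc m"
    if "u \<in> self_modified d" "max_letter u = m" "a \<in> {1..Suc m - d}" for u a
    using that self_modified_snoc[of "u @ [Suc m]" a d] max_letter_snoc[of "u @ [Suc m]" a]
    by (auto simp: self_modified_snoc)
  moreover assume ?R
  ultimately show ?L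
    by (auto simp: self_modified_snoc)
qed

lemma card_level_words_Suc:
  assumes "Suc m \<le> 2 * d"
  shows "card (level_words d (Suc m) (Suc n)) =
    card (level_words d m n) +
    (if n = 0 then 0 else (Suc m - d) * card (level_words d m (n - 1)))"
proof -
  define A where "A = (\<lambda>u. u @ [Suc m]) ` level_words d m n"
  define S where "S = (if n = 0 then {} else level_words d m (n - 1))"
  define B where "B = (\<lambda>(u, a). u @ [Suc m, a]) ` (S \<times> {1..Suc m - d})"
  have S: "u \<in> S \<longleftrightarrow> u \<in> self_modified d \<and> max_letter u = m \<and> Suc (length u) = n" for u
    by (cases n) (auto simp: S_def level_words_def)
  have "level_words d (Suc m) (Suc n) = A \<union> B"
  proof (rule set_eqI)
    fix w
    have "w \<in> A \<longleftrightarrow>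
        (\<exists>u\<in>self_modified d. max_letter u = m \<and> length w = Suc n \<and> w = u @ [Suc m])"
      unfolding A_def level_words_def by fastforce
    moreover have "w \<in> B \<longleftrightarrow> (\<exists>u\<in>self_modified d. max_letter u = m \<and>
        (\<exists>a\<in>{1..Suc m - d}. length w = Suc n \<and> w = u @ [Suc m, a]))"
      unfolding B_def image_iff Bex_def split_paired_Ex mem_Times_iff S by fastforce
    moreover have "w \<in> level_words d (Suc m) (Suc n) \<longleftrightarrow>
        length w = Suc n \<and> (w \<in> self_modified d \<and> max_letter w = Suc m)"
      by (auto simp: level_words_def)
    ultimately show "w \<in> level_words d (Suc m) (Suc n) \<longleftrightarrow> w \<in> A \<union> B"
      unfolding self_modified_max_letter_Suc[OF assms] Un_iff by blast
  qed
  moreover have "finite A" "finite B"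
    by (simp_all add: A_def B_def S_def)
  \<comment> \<open>The assumption forces \<open>0 < d\<close>, so words in \<open>B\<close> end in
    a letter below \<open>Suc m\<close>, while those in \<open>A\<close> end in
    \<open>Suc m\<close>.\<close>
  moreover have "A \<inter> B = {}"
    using assms by (auto simp: A_def B_def)
  moreover have "card A = card (level_words d m n)"
    unfolding A_def by (rule card_image) (auto simp: inj_on_def)
  moreover have "card B = card (S \<times> {1..Suc m - d})"
    unfolding B_def by (rule card_image) (auto simp: inj_on_def)
  ultimately show ?thesis
    by (simp add: card_Un_disjoint S_def card_cartesian_product)
qed

section \<open>Generating functions of the levels\<close>

definition level_gf :: "nat \<Rightarrow> nat \<Rightarrow> int poly fps" where
  "level_gf d m = Abs_fps (\<lambda>n. of_nat (card (level_words d m n)))"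

lemma level_gf_0: "level_gf d 0 = 1"
proof (rule fps_ext)
  fix n
  have "w \<in> level_words d 0 n \<longleftrightarrow> w = [] \<and> n = 0" for w
    unfolding level_words_def using self_modified_max_letter_0_iff[of w d] by auto
  then have "level_words d 0 n = (if n = 0 then {[]} else {})"
    by (simp add: set_eq_iff)
  then show "fps_nth (level_gf d 0) n = fps_nth 1 n"
    by (simp add: level_gf_def)
qed

lemma level_gf_Suc:
  assumes "Suc m \<le> 2 * d"
  shows "level_gf d (Suc m) = fps_X * (1 + of_nat (Suc m - d) * fps_X) * level_gf d m"
proof (rule fps_ext)
  fix n
  define c where "c = Suc m - d"
  \<comment> \<open>Each \<open>fps_X\<close> now acts as a shift: the outer one for the new
    maximum, the inner one for the optional small letter.\<close>
  have "fps_X * (1 + of_nat c * fps_X) * f = fps_X * (f + fps_X * (of_nat c * f))"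
    for f :: "int poly fps"
    by (simp only: distrib_left distrib_right mult_1_left mult_ac)
  moreover have "fps_nth (level_gf d (Suc m)) n =
      fps_nth (fps_X * (level_gf d m + fps_X * (of_nat c * level_gf d m))) n"
  proof (cases n)
    case 0
    then show ?thesis
      by (simp add: level_gf_def level_words_Suc_0)
  next
    case (Suc l)
    then show ?thesis
      by (simp add: level_gf_def card_level_words_Suc[OF assms, folded c_def])
  qed
  ultimately show "fps_nth (level_gf d (Suc m)) n =
      fps_nth (fps_X * (1 + of_nat (Suc m - d) * fps_X) * level_gf d m) n"
    unfolding c_def by (simp only:)
qed

lemma level_gf_le: "m \<le> d \<Longrightarrow> level_gf d m = fps_X ^ m"
  by (induction m) (simp_all add: level_gf_0 level_gf_Suc)

text \<open>For \<open>k \<le> d\<close> every level up to \<open>d + k\<close> stays within the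
  bound \<open>2 * d\<close> of the recursion, and level \<open>d + i\<close> brings the coefficient
  \<open>i\<close>.\<close>

lemma level_gf_add:
  "k \<le> d \<Longrightarrow> level_gf d (d + k) = fps_X ^ d * (fps_X ^ k * (\<Prod>i=1..k. 1 + of_nat i * fps_X))"
proof (induction k)
  case 0
  then show ?case by (simp add: level_gf_le)
next
  case (Suc k)
  then have "level_gf d (d + Suc k) =
      fps_X * (1 + of_nat (Suc k) * fps_X) *
      (fps_X ^ d * (fps_X ^ k * (\<Prod>i=1..k. 1 + of_nat i * fps_X)))"
    using level_gf_Suc[of "d + k" d] by simp
  then show ?case
    by (simp add: mult_ac)
qed

text \<open>The power of \<open>q\<close> is constant on a level, so it can be restored after
  counting; levels above \<open>n\<close> are empty because the maximum is at most the
  length.\<close>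

lemma self_modified_gf_nth:
  "fps_nth (self_modified_gf d) n = (\<Sum>m\<le>n. monom 1 m * fps_nth (level_gf d m) n)"
proof -
  let ?S = "{w \<in> self_modified d. length w = n}"
  have "fps_nth (self_modified_gf d) n =
      (\<Sum>m\<le>n. \<Sum>w\<in>{w \<in> ?S. max_letter w = m}. monom 1 (max_letter w))"
    unfolding self_modified_gf_def fps_nth_Abs_fps
    by (rule sum.group[symmetric])
      (use finite_self_modified_length max_letter_le_length in auto)
  also have "\<dots> = (\<Sum>m\<le>n. monom 1 m * fps_nth (level_gf d m) n)"
  proof (rule sum.cong[OF refl])
    fix m
    have "{w \<in> ?S. max_letter w = m} = level_words d m n"
      by (auto simp: level_words_def)
    moreover have "(\<Sum>w\<in>level_words d m n. monom 1 (max_letter w)) =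
        (\<Sum>w\<in>level_words d m n. monom (1 :: int) m)"
      by (rule sum.cong) (auto simp: level_words_def)
    ultimately show "(\<Sum>w\<in>{w \<in> ?S. max_letter w = m}. monom 1 (max_letter w)) =
        monom 1 m * fps_nth (level_gf d m) n"
      by (simp add: level_gf_def mult.commute)
  qed
  finally show ?thesis .
qed

section \<open>Removing the bracket, dividing, and passing to the limit\<close>

lemma qx_power: "(q * x) ^ k = fps_X ^ k * fps_const (monom 1 k)"
  by (simp add: q_def x_def power_mult_distrib fps_const_power monom_power mult.commute)

lemma qx_power_mult_nth:
  "fps_nth ((q * x) ^ k * f) n = (if n < k then 0 else monom 1 k * fps_nth f (n - k))"
  by (simp add: qx_power mult.assoc fps_X_power_mult_nth)

lemma bracket_nth: "fps_nth (bracket d (q * x)) n = (if n < d then monom 1 n else 0)"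
proof -
  have "fps_nth ((q * x) ^ k) n = (if k = n then monom 1 n else 0)" for k
    using qx_power_mult_nth[of k 1 n] by auto
  then show ?thesis
    by (simp add: bracket_def fps_sum_nth)
qed

text \<open>The levels from \<open>d\<close> on, with the exponents of both \<open>q\<close> and
  \<open>x\<close> lowered by \<open>d\<close>.\<close>

definition quotient_gf :: "nat \<Rightarrow> int poly fps" where
  "quotient_gf d =
     Abs_fps (\<lambda>n. \<Sum>k\<le>n. monom 1 k * fps_nth (level_gf d (d + k)) (d + n))"

lemma qx_power_mult_quotient_gf:
  "(q * x) ^ d * quotient_gf d = self_modified_gf d - bracket d (q * x)"
proof (rule fps_ext)
  fix n
  \<comment> \<open>Each level below \<open>d\<close> contains a single word, so these levels
    together contribute exactly the bracket.\<close>
  have low: "fps_nth (level_gf d m) n = (if m = n then 1 else 0)" if "m < d" for m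
    using that by (simp add: level_gf_le)
  show "fps_nth ((q * x) ^ d * quotient_gf d) n =
      fps_nth (self_modified_gf d - bracket d (q * x)) n"
  proof (cases "n < d")
    case True
    then have "fps_nth (self_modified_gf d) n = (\<Sum>m\<le>n. if m = n then monom 1 n else 0)"
      unfolding self_modified_gf_nth by (intro sum.cong) (auto simp: low)
    with True show ?thesis
      by (simp add: qx_power_mult_nth bracket_nth)
  next
    case False
    then obtain l where n: "n = d + l"
      by (metis le_add_diff_inverse not_less)
    have "fps_nth (self_modified_gf d) n =
        (\<Sum>m\<in>{d..d + l}. monom 1 m * fps_nth (level_gf d m) n)"
      unfolding self_modified_gf_nth
      by (rule sum.mono_neutral_right) (use n low in auto)
    also have "\<dots> = (\<Sum>k\<le>l. monom 1 (d + k) * fps_nth (level_gf d (d + k)) n)"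
      by (rule sum.reindex_bij_witness[of _ "\<lambda>k. d + k" "\<lambda>m. m - d"]) auto
    also have "\<dots> = monom 1 d * fps_nth (quotient_gf d) l"
      by (simp add: quotient_gf_def n sum_distrib_left mult_monom flip: mult.assoc)
    finally show ?thesis
      using n by (simp add: qx_power_mult_nth bracket_nth)
  qed
qed

text \<open>Only levels \<open>d + k\<close> with \<open>k \<le> n \<le> d\<close> enter, where the
  product formula is valid. Hence the coefficient of index \<open>n\<close> is constant from
  \<open>d = n\<close> on.\<close>

lemma quotient_gf_nth:
  assumes "n \<le> d"
  shows "fps_nth (quotient_gf d) n = (\<Sum>k\<le>n. fps_nth (rhs_term k) n)"
proof -
  have "monom 1 k * fps_nth (level_gf d (d + k)) (d + n) = fps_nth (rhs_term k) n"
    if "k \<le> n" for k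
    using that assms
    by (simp add: level_gf_add fps_X_power_mult_nth rhs_term_def qx_power_mult_nth)
      (simp add: x_def)
  then show ?thesis
    by (simp add: quotient_gf_def)
qed

text \<open>The product identity expresses the division: \<open>int poly fps\<close> is an integral
  domain and \<open>q * x\<close> is nonzero, so it determines each \<open>G d\<close>.\<close>

theorem theorem4p5:
  shows "\<exists>G :: nat \<Rightarrow> int poly fps.
    (\<forall>d. (q * x) ^ d * G d = self_modified_gf d - bracket d (q * x)) \<and>
    G \<longlonglongrightarrow> (\<Sum>k. (q * x) ^ k * (\<Prod>i=1..k. 1 + of_nat i * x))"
proof -
  have "quotient_gf \<longlonglongrightarrow> suminf rhs_term"
    unfolding LIMSEQ_fps_iff sums_unique[OF rhs_term_sums, symmetric]
    using quotient_gf_nth by auto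
  then show ?thesis
    using qx_power_mult_quotient_gf unfolding rhs_term_def by blast
qed

end
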